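(* Let $\alpha\ge0$ and let $A_1=\tilde A_0+\alpha$, $B_1=\tilde B_0$, $C_1=\tilde C_0-\alpha(q^n)^2$ be the coefficients (defined in the context) of the equation $$A_1(q^{n+1})^2+B_1q^{n+1}+C_1=0$$ for the unknown $q^{n+1}$ arising in the RLM-Q-CN scheme (relaxed Lagrange multiplier scheme with quadratization, Crank--Nicolson version) for the double-well potential. Assume $q^n>0$. Then this equation has at least one real solution in the following cases: 1. If $(\tilde A_0(q^n)^2+\tilde C_0)^2<(q^n)^2\tilde B_0^2$, then the equation is solvable for any $\alpha\ge0$. 2. If $(\tilde A_0(q^n)^2+\tilde C_0)^2\ge(q^n)^2\tilde B_0^2$, then the equation is solvable when $$\alpha\ge\alpha^*:=\max\left\{0,\ \frac{\tilde C_0-\tilde A_0(q^n)^2+\sqrt{(\tilde A_0(q^n)^2+\tilde C_0)^2-(q^n)^2\tilde B_0^2}}{2(q^n)^2}\right\}.$$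
   Context: Setting. $\Omega\subset\mathbb R^d$ is a bounded domain; $\mathcal L$ and $\mathcal M$ are linear, self-adjoint, non-negative operators with respect to the $L^2(\Omega)$ inner product (with homogeneous Neumann or periodic boundary conditions); $\Delta t>0$ is the time step; $F(\phi)=\frac14(\phi^2-1)^2$ and $f(\phi)=F'(\phi)=\phi(\phi^2-1)$. The operator $\mathcal G:=\frac1{\Delta t}I+\frac12\mathcal M\mathcal L$ is assumed invertible. The previous iterates $\phi^n,\phi^{n-1},\phi^{n-2}$ (sufficiently regular functions on $\Omega$) and the scalar $q^n\in\mathbb R$ are given; $\alpha\ge0$ is the relaxation parameter. Extrapolations: $\overline\phi^{\,n+\frac12}=\frac32\phi^n-\frac12\phi^{n-1}$, $\overline\phi^{\,n+1}=2\phi^n-\phi^{n-1}$, $\overline\phi^{\,n}=2\phi^{n-1}-\phi^{n-2}$. Also $q^{n+\frac12}=\frac12(q^n+q^{n+1})$. The functions $\phi_1^{n+1},\phi_2^{n+1}$ are defined by $$\mathcal G\phi_1^{n+1}=\frac1{\Delta t}\phi^n-\frac12\mathcal M\mathcal L\phi^n-\frac12\mathcal M\,q^nf(\overline\phi^{\,n+\frac12}),\qquad \mathcal G\phi_2^{n+1}=-\frac12\mathcal M f(\overline\phi^{\,n+\frac12}),$$ and the new iterate is $\phi^{n+1}=\phi_1^{n+1}+q^{n+1}\phi_2^{n+1}$. With $F^{n+1}=\frac14(\phi^{n+1}\overline\phi^{\,n+1}-1)^2$ and $F^n=\frac14(\phi^n\overline\phi^{\,n}-1)^2$, the scalar $q^{n+1}$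 is determined by $$\int_\Omega(F^{n+1}-F^n)\,d\mathbf x+\alpha\big[(q^{n+1})^2-(q^n)^2\big]=q^{n+\frac12}\int_\Omega f(\overline\phi^{\,n+\frac12})(\phi^{n+1}-\phi^n)\,d\mathbf x,$$ which is the equation $A_1(q^{n+1})^2+B_1q^{n+1}+C_1=0$ with $A_1=\tilde A_0+\alpha$, $B_1=\tilde B_0$, $C_1=\tilde C_0-\alpha(q^n)^2$, where $$A_0=\int_\Omega\tfrac14(\overline\phi^{\,n+1}\phi_2^{n+1})^2d\mathbf x,\quad B_0=\int_\Omega\tfrac12(\overline\phi^{\,n+1}\phi_1^{n+1}-1)\,\overline\phi^{\,n+1}\phi_2^{n+1}d\mathbf x,\quad C_0=\int_\Omega\tfrac14(\overline\phi^{\,n+1}\phi_1^{n+1}-1)^2d\mathbf x,$$ $$\tilde A_0=A_0-\tfrac12\int_\Omega f(\overline\phi^{\,n+\frac12})\phi_2^{n+1}d\mathbf x,$$ $$\tilde B_0=B_0-\tfrac12\int_\Omega f(\overline\phi^{\,n+\frac12})(\phi_1^{n+1}-\phi^n)\,d\mathbf x-\tfrac12q^n\int_\Omega f(\overline\phi^{\,n+\frac12})\phi_2^{n+1}d\mathbf x,$$ $$\tilde C_0=C_0-\int_\Omega\tfrac14(\phi^n\overline\phi^{\,n}-1)^2d\mathbf x-\tfrac12q^n\int_\Omega f(\overline\phi^{\,n+\frac12})(\phi_1^{n+1}-\phi^n)\,d\mathbf x.$$ The assumption $q^n>0$ is consistent with the scheme's root-selection criterion $q^{n+1}\approx q^n\approx1$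 (when two real roots exist, the one closest to $q^n$ is chosen).
   Formalization: In case 2 with α = 0 it is additionally assumed that Ã₀ and B̃₀ are not both zero; otherwise the claim can fail (e.g. φⁿ = φⁿ⁻¹ = 1, φⁿ⁻² = 0, L1 = 0 gives −|Ω|/4 = 0). *)

theory Defs
  imports "HOL-Analysis.Analysis"
begin

section \<open>Square-integrable functions and unbounded operators on \<open>L\<^sup>2(\<Omega>)\<close>\<close>

text \<open>Elements of \<open>L\<^sup>2(\<Omega>)\<close> are represented by functions, of which only the values on
  \<open>\<Omega>\<close> up to a Lebesgue null set matter: equality in \<open>L\<^sup>2(\<Omega>)\<close> is \<open>ae_eq \<Omega>\<close>.\<close>

definition ae_eq :: "'a::euclidean_space set \<Rightarrow> ('a \<Rightarrow> real) \<Rightarrow> ('a \<Rightarrow> real) \<Rightarrow> bool" where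
  "ae_eq \<Omega> u v \<longleftrightarrow> (AE x in lebesgue_on \<Omega>. u x = v x)"

definition L2 :: "'a::euclidean_space set \<Rightarrow> ('a \<Rightarrow> real) set" where
  "L2 \<Omega> = {u \<in> borel_measurable (lebesgue_on \<Omega>). integrable (lebesgue_on \<Omega>) (\<lambda>x. (u x)\<^sup>2)}"

definition Linfty :: "'a::euclidean_space set \<Rightarrow> ('a \<Rightarrow> real) set" where
  "Linfty \<Omega> = {u \<in> borel_measurable (lebesgue_on \<Omega>). \<exists>K. AE x in lebesgue_on \<Omega>. \<bar>u x\<bar> \<le> K}"

definition int_on :: "'a::euclidean_space set \<Rightarrow> ('a \<Rightarrow> real) \<Rightarrow> real" where
  "int_on \<Omega> u = (LINT x|lebesgue_on \<Omega>. u x)"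

definition L2_inner :: "'a::euclidean_space set \<Rightarrow> ('a \<Rightarrow> real) \<Rightarrow> ('a \<Rightarrow> real) \<Rightarrow> real" where
  "L2_inner \<Omega> u v = int_on \<Omega> (\<lambda>x. u x * v x)"

text \<open>A possibly unbounded operator is a domain \<open>D\<close> together with a map \<open>T\<close>, whose values
  outside \<open>D\<close> are irrelevant. Boundary conditions are part of \<open>D\<close>. Linearity of \<open>T\<close>
  includes compatibility with equality almost everywhere.\<close>

definition linear_operator ::
  "'a::euclidean_space set \<Rightarrow> ('a \<Rightarrow> real) set \<Rightarrow> (('a \<Rightarrow> real) \<Rightarrow> ('a \<Rightarrow> real)) \<Rightarrow> bool" where
  "linear_operator \<Omega> D T \<longleftrightarrow>
     D \<subseteq> L2 \<Omega> \<and> (\<lambda>x. 0) \<in> D \<and>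
     (\<forall>u\<in>D. \<forall>v\<in>L2 \<Omega>. ae_eq \<Omega> u v \<longrightarrow> v \<in> D \<and> ae_eq \<Omega> (T u) (T v)) \<and>
     (\<forall>u\<in>D. T u \<in> L2 \<Omega>) \<and>
     (\<forall>u\<in>D. \<forall>v\<in>D. (\<lambda>x. u x + v x) \<in> D \<and>
        ae_eq \<Omega> (T (\<lambda>x. u x + v x)) (\<lambda>x. T u x + T v x)) \<and>
     (\<forall>c. \<forall>u\<in>D. (\<lambda>x. c * u x) \<in> D \<and> ae_eq \<Omega> (T (\<lambda>x. c * u x)) (\<lambda>x. c * T u x))"

definition densely_defined :: "'a::euclidean_space set \<Rightarrow> ('a \<Rightarrow> real) set \<Rightarrow> bool" where
  "densely_defined \<Omega> D \<longleftrightarrow>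
     (\<forall>u\<in>L2 \<Omega>. \<forall>e>0. \<exists>v\<in>D. L2_inner \<Omega> (\<lambda>x. u x - v x) (\<lambda>x. u x - v x) < e)"

text \<open>Self-adjointness proper: the adjoint extends \<open>T\<close> (symmetry) and its domain is no larger
  than \<open>D\<close>.\<close>

definition self_adjoint ::
  "'a::euclidean_space set \<Rightarrow> ('a \<Rightarrow> real) set \<Rightarrow> (('a \<Rightarrow> real) \<Rightarrow> ('a \<Rightarrow> real)) \<Rightarrow> bool" where
  "self_adjoint \<Omega> D T \<longleftrightarrow>
     densely_defined \<Omega> D \<and>
     (\<forall>u\<in>D. \<forall>v\<in>D. L2_inner \<Omega> (T u) v = L2_inner \<Omega> u (T v)) \<and>
     (\<forall>v\<in>L2 \<Omega>. (\<exists>w\<in>L2 \<Omega>. \<forall>u\<in>D. L2_inner \<Omega> (T u) v = L2_inner \<Omega> u w) \<longrightarrow> v \<in> D)"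

definition nonneg_operator ::
  "'a::euclidean_space set \<Rightarrow> ('a \<Rightarrow> real) set \<Rightarrow> (('a \<Rightarrow> real) \<Rightarrow> ('a \<Rightarrow> real)) \<Rightarrow> bool" where
  "nonneg_operator \<Omega> D T \<longleftrightarrow> (\<forall>u\<in>D. 0 \<le> L2_inner \<Omega> (T u) u)"

definition invertible_operator ::
  "'a::euclidean_space set \<Rightarrow> ('a \<Rightarrow> real) set \<Rightarrow> (('a \<Rightarrow> real) \<Rightarrow> ('a \<Rightarrow> real)) \<Rightarrow> bool" where
  "invertible_operator \<Omega> D T \<longleftrightarrow>
     (\<forall>g\<in>L2 \<Omega>. \<exists>u\<in>D. ae_eq \<Omega> (T u) g \<and> (\<forall>v\<in>D. ae_eq \<Omega> (T v) g \<longrightarrow> ae_eq \<Omega> u v))"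

text \<open>The domain of the composition \<open>M L\<close>.\<close>

definition comp_dom ::
  "('a \<Rightarrow> real) set \<Rightarrow> ('a \<Rightarrow> real) set \<Rightarrow> (('a \<Rightarrow> real) \<Rightarrow> ('a \<Rightarrow> real)) \<Rightarrow> ('a \<Rightarrow> real) set" where
  "comp_dom DM DL L = {u \<in> DL. L u \<in> DM}"


section \<open>The numerical scheme\<close>

definition F :: "real \<Rightarrow> real" where
  "F p = 1/4 * (p\<^sup>2 - 1)\<^sup>2"

definition f :: "real \<Rightarrow> real" where
  "f p = p * (p\<^sup>2 - 1)"

lemma F_has_derivative_f: "(F has_real_derivative f p) (at p)"
  unfolding F_def f_def
  by (auto intro!: derivative_eq_intros simp: algebra_simps power2_eq_square)

definition G_op ::
  "real \<Rightarrow> (('a \<Rightarrow> real) \<Rightarrow> ('a \<Rightarrow> real)) \<Rightarrow> (('a \<Rightarrow> real) \<Rightarrow> ('a \<Rightarrow> real)) \<Rightarrow>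
   ('a \<Rightarrow> real) \<Rightarrow> ('a \<Rightarrow> real)" where
  "G_op dt M L u = (\<lambda>x. 1/dt * u x + 1/2 * M (L u) x)"

text \<open>With \<open>u\<close>, \<open>v\<close> two consecutive iterates, \<open>u\<close> the more recent: extrapolation to half a step
  and to a full step after \<open>u\<close>.\<close>

definition extrap_half :: "('a \<Rightarrow> real) \<Rightarrow> ('a \<Rightarrow> real) \<Rightarrow> ('a \<Rightarrow> real)" where
  "extrap_half u v = (\<lambda>x. 3/2 * u x - 1/2 * v x)"

definition extrap :: "('a \<Rightarrow> real) \<Rightarrow> ('a \<Rightarrow> real) \<Rightarrow> ('a \<Rightarrow> real)" where
  "extrap u v = (\<lambda>x. 2 * u x - v x)"

text \<open>Below, \<open>fh\<close> stands for \<open>f\<close> of the half-step extrapolation, \<open>pb1\<close> for the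
  extrapolation to time level \<open>n+1\<close> and \<open>pb0\<close> for the one to level \<open>n\<close>; \<open>p\<close> is
  \<open>\<phi>\<^sup>n\<close>, \<open>q\<close> is \<open>q\<^sup>n\<close>, and \<open>p1\<close>, \<open>p2\<close> are the two parts of the splitting
  \<open>\<phi>\<^sup>n\<^sup>+\<^sup>1 = p1 + q\<^sup>n\<^sup>+\<^sup>1 p2\<close>.\<close>

definition A0 where
  "A0 \<Omega> pb1 p2 = int_on \<Omega> (\<lambda>x. 1/4 * (pb1 x * p2 x)\<^sup>2)"

definition B0 where
  "B0 \<Omega> pb1 p1 p2 = int_on \<Omega> (\<lambda>x. 1/2 * (pb1 x * p1 x - 1) * pb1 x * p2 x)"

definition C0 where
  "C0 \<Omega> pb1 p1 = int_on \<Omega> (\<lambda>x. 1/4 * (pb1 x * p1 x - 1)\<^sup>2)"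

definition A0_tilde where
  "A0_tilde \<Omega> fh pb1 p2 = A0 \<Omega> pb1 p2 - 1/2 * int_on \<Omega> (\<lambda>x. fh x * p2 x)"

definition B0_tilde where
  "B0_tilde \<Omega> q p fh pb1 p1 p2 =
     B0 \<Omega> pb1 p1 p2 - 1/2 * int_on \<Omega> (\<lambda>x. fh x * (p1 x - p x))
       - 1/2 * q * int_on \<Omega> (\<lambda>x. fh x * p2 x)"

definition C0_tilde where
  "C0_tilde \<Omega> q p fh pb1 pb0 p1 =
     C0 \<Omega> pb1 p1 - int_on \<Omega> (\<lambda>x. 1/4 * (p x * pb0 x - 1)\<^sup>2)
       - 1/2 * q * int_on \<Omega> (\<lambda>x. fh x * (p1 x - p x))"

definition alpha_star :: "real \<Rightarrow> real \<Rightarrow> real \<Rightarrow> real \<Rightarrow> real" where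
  "alpha_star At Bt Ct q =
     max 0 ((Ct - At * q\<^sup>2 + sqrt ((At * q\<^sup>2 + Ct)\<^sup>2 - q\<^sup>2 * Bt\<^sup>2)) / (2 * q\<^sup>2))"

end

theory Submission
  imports Defs "HOL-Library.Quadratic_Discriminant"
begin

text \<open>Up to the factor \<open>q\<^sup>2\<close>, the discriminant of the equation is
  \<open>q\<^sup>2 Bt\<^sup>2 - (At q\<^sup>2 + Ct)\<^sup>2 + (2 \<alpha> q\<^sup>2 + At q\<^sup>2 - Ct)\<^sup>2\<close>: it is positive in the first case, and in the
  second one the threshold for \<open>\<alpha>\<close> makes the last square dominate the other two terms.
  What remains is a vanishing leading coefficient. The scheme rules it out for \<open>\<alpha> > 0\<close>, because
  \<open>At \<ge> 0\<close>: with \<open>w = f + L \<phi>\<^sub>2\<close>, the equation for \<open>\<phi>\<^sub>2\<close> reads \<open>\<phi>\<^sub>2 = - (dt/2) M w\<close>, so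
  \<open>\<langle>f, \<phi>\<^sub>2\<rangle> = - (dt/2) \<langle>M w, w\<rangle> - \<langle>L \<phi>\<^sub>2, \<phi>\<^sub>2\<rangle> \<le> 0\<close>.\<close>

lemma L2_mult_integrable:
  assumes "u \<in> L2 \<Omega>" "v \<in> L2 \<Omega>"
  shows "integrable (lebesgue_on \<Omega>) (\<lambda>x. u x * v x)"
proof (rule Bochner_Integration.integrable_bound)
  show "integrable (lebesgue_on \<Omega>) (\<lambda>x. (u x)\<^sup>2 + (v x)\<^sup>2)"
    using assms by (auto simp: L2_def)
  show "(\<lambda>x. u x * v x) \<in> borel_measurable (lebesgue_on \<Omega>)"
    using assms by (auto simp: L2_def)
  have "\<bar>a * b\<bar> \<le> a\<^sup>2 + b\<^sup>2" for a b :: real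
  proof -
    have "2 * (\<bar>a\<bar> * \<bar>b\<bar>) \<le> a\<^sup>2 + b\<^sup>2"
      using sum_squares_bound[of "\<bar>a\<bar>" "\<bar>b\<bar>"] by simp
    moreover have "0 \<le> \<bar>a\<bar> * \<bar>b\<bar>"
      by simp
    ultimately show ?thesis
      unfolding abs_mult by linarith
  qed
  then show "AE x in lebesgue_on \<Omega>. norm (u x * v x) \<le> norm ((u x)\<^sup>2 + (v x)\<^sup>2)"
    by auto
qed

text \<open>With \<open>h\<close> and \<open>p\<close> taken as \<open>fh\<close> and
  \<open>phi2\<close>, this fixes the sign of the term that \<open>A0_tilde\<close> subtracts.
  Nonnegativity of \<open>M\<close> is used at \<open>w\<close>, that of \<open>L\<close> at
  \<open>p\<close>.\<close>

lemma L2_inner_nonpos: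
  assumes L: "linear_operator \<Omega> DL L" "nonneg_operator \<Omega> DL L"
    and M: "linear_operator \<Omega> DM M" "nonneg_operator \<Omega> DM M"
    and dt: "dt > 0"
    and h: "h \<in> DM"
    and p: "p \<in> comp_dom DM DL L"
      "ae_eq \<Omega> (G_op dt M L p) (\<lambda>x. - (1/2) * M h x)"
  shows "L2_inner \<Omega> h p \<le> 0"
proof -
  define w where "w = (\<lambda>x. h x + L p x)"
  have pL: "p \<in> DL" "L p \<in> DM"
    using p(1) by (auto simp: comp_dom_def)
  have w: "w \<in> DM" "ae_eq \<Omega> (M w) (\<lambda>x. M h x + M (L p) x)"
    using M(1) h pL unfolding linear_operator_def w_def by blast+
  have L2: "p \<in> L2 \<Omega>" "L p \<in> L2 \<Omega>" "w \<in> L2 \<Omega>" "M w \<in> L2 \<Omega>"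
    using L(1) M(1) pL w(1) unfolding linear_operator_def by blast+
  have "AE x in lebesgue_on \<Omega>. w x * p x = - (dt/2) * (M w x * w x)"
    using p(2)[unfolded ae_eq_def G_op_def] w(2)[unfolded ae_eq_def]
  proof eventually_elim
    case (elim x)
    then have "p x = - (dt/2) * M w x"
      using dt by (simp add: field_simps)
    then show ?case
      by (simp add: algebra_simps)
  qed
  then have "int_on \<Omega> (\<lambda>x. w x * p x) = int_on \<Omega> (\<lambda>x. - (dt/2) * (M w x * w x))"
    unfolding int_on_def using L2 by (intro integral_cong_AE) (auto simp: L2_def)
  also have "\<dots> = - (dt/2) * L2_inner \<Omega> (M w) w"
    unfolding int_on_def L2_inner_def by (rule integral_mult_right_zero)
  also have "\<dots> \<le> 0"
    using dt M(2) w(1) by (auto simp: nonneg_operator_def)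
  finally have "int_on \<Omega> (\<lambda>x. w x * p x) \<le> 0" .
  moreover have "0 \<le> L2_inner \<Omega> (L p) p"
    using L(2) pL(1) by (auto simp: nonneg_operator_def)
  moreover have "L2_inner \<Omega> h p = int_on \<Omega> (\<lambda>x. w x * p x) - L2_inner \<Omega> (L p) p"
  proof -
    have "(\<lambda>x. h x * p x) = (\<lambda>x. w x * p x - L p x * p x)"
      by (simp add: w_def algebra_simps)
    then show ?thesis
      unfolding int_on_def L2_inner_def
      using Bochner_Integration.integral_diff[OF L2_mult_integrable L2_mult_integrable] L2
      by simp
  qed
  ultimately show ?thesis
    by linarith
qed

lemma A0_tilde_nonneg:
  assumes "L2_inner \<Omega> h p \<le> 0"
  shows "0 \<le> A0_tilde \<Omega> h pb p"
proof -
  \<comment> \<open>The integrand is a square; if it is not integrable, its Bochner integral is 0 by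
    convention, so the sign is right in either case.\<close>
  have "0 \<le> A0 \<Omega> pb p"
    unfolding A0_def int_on_def by (rule integral_nonneg_AE) simp
  with assms show ?thesis
    by (simp add: A0_tilde_def L2_inner_def)
qed

text \<open>For \<open>a = 0\<close> the discriminant is a square and carries no information; the
  second assumption then leaves a linear equation.\<close>

lemma quadratic_root_exists:
  fixes a b c :: real
  assumes "0 \<le> discrim a b c" "a \<noteq> 0 \<or> b \<noteq> 0"
  shows "\<exists>x. a * x\<^sup>2 + b * x + c = 0"
proof (cases "a = 0")
  case True
  with assms(2) have "a * (- c / b)\<^sup>2 + b * (- c / b) + c = 0"
    by simp
  then show ?thesis ..
next
  case False
  with assms(1) show ?thesis
    using discriminant_iff by blast
qed

text \<open>Put X = (A + \<alpha>) q^2 and Y = C - \<alpha> q^2, and write 4XY = (X + Y)^2 - (X -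
  Y)^2. The relaxation parameter cancels in X + Y and survives only in X - Y.\<close>

lemma discrim_relaxed:
  fixes A B C q \<alpha> :: real
  shows "q\<^sup>2 * discrim (A + \<alpha>) B (C - \<alpha> * q\<^sup>2)
    = q\<^sup>2 * B\<^sup>2 - (A * q\<^sup>2 + C)\<^sup>2 + (2 * \<alpha> * q\<^sup>2 + A * q\<^sup>2 - C)\<^sup>2"
  unfolding discrim_def by algebra

text \<open>The proviso for \<alpha> = 0 in the second case excludes the equation
  \<open>Ct = 0\<close> without unknown: if \<open>At\<close> and \<open>Bt\<close> vanish and
  \<open>Ct\<close> is negative, then \<open>alpha_star\<close> is 0, yet there is no root at
  \<alpha> = 0.\<close>

theorem lemma3p1:
  fixes \<Omega> :: "(real ^ 'd) set"
    and L M :: "(real ^ 'd \<Rightarrow> real) \<Rightarrow> (real ^ 'd \<Rightarrow> real)"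
    and DL DM :: "(real ^ 'd \<Rightarrow> real) set"
    and phi phi_prev phi_prev2 phi1 phi2 fh pb1 pb0 :: "real ^ 'd \<Rightarrow> real"
    and dt q \<alpha> At Bt Ct A1 B1 C1 :: real
  assumes domain: "open \<Omega>" "connected \<Omega>" "\<Omega> \<noteq> {}" "bounded \<Omega>"
    and L: "linear_operator \<Omega> DL L" "self_adjoint \<Omega> DL L" "nonneg_operator \<Omega> DL L"
    and M: "linear_operator \<Omega> DM M" "self_adjoint \<Omega> DM M" "nonneg_operator \<Omega> DM M"
    and dt: "dt > 0"
    and G_invertible: "invertible_operator \<Omega> (comp_dom DM DL L) (G_op dt M L)"
    and fh: "fh = (\<lambda>x. f (extrap_half phi phi_prev x))"
    and pb1: "pb1 = extrap phi phi_prev"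
    and pb0: "pb0 = extrap phi_prev phi_prev2"
    and regularity: "phi \<in> Linfty \<Omega>" "phi_prev \<in> Linfty \<Omega>" "phi_prev2 \<in> Linfty \<Omega>"
      "phi \<in> comp_dom DM DL L" "fh \<in> DM"
    and phi1: "phi1 \<in> comp_dom DM DL L"
      "ae_eq \<Omega> (G_op dt M L phi1)
         (\<lambda>x. 1/dt * phi x - 1/2 * M (L phi) x - 1/2 * M (\<lambda>y. q * fh y) x)"
    and phi2: "phi2 \<in> comp_dom DM DL L"
      "ae_eq \<Omega> (G_op dt M L phi2) (\<lambda>x. - (1/2) * M fh x)"
    and At: "At = A0_tilde \<Omega> fh pb1 phi2"
    and Bt: "Bt = B0_tilde \<Omega> q phi fh pb1 phi1 phi2"
    and Ct: "Ct = C0_tilde \<Omega> q phi fh pb1 pb0 phi1"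
    and A1: "A1 = At + \<alpha>"
    and B1: "B1 = Bt"
    and C1: "C1 = Ct - \<alpha> * q\<^sup>2"
    and q: "q > 0"
    and \<alpha>: "\<alpha> \<ge> 0"
  shows "((At * q\<^sup>2 + Ct)\<^sup>2 < q\<^sup>2 * Bt\<^sup>2 \<longrightarrow>
            (\<exists>r::real. A1 * r\<^sup>2 + B1 * r + C1 = 0)) \<and>
         ((At * q\<^sup>2 + Ct)\<^sup>2 \<ge> q\<^sup>2 * Bt\<^sup>2 \<and> \<alpha> \<ge> alpha_star At Bt Ct q \<and>
            (\<alpha> = 0 \<longrightarrow> At \<noteq> 0 \<or> Bt \<noteq> 0) \<longrightarrow>
            (\<exists>r::real. A1 * r\<^sup>2 + B1 * r + C1 = 0))"
proof -
  have At0: "0 \<le> At"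
    unfolding At using L M dt regularity(5) phi2
    by (intro A0_tilde_nonneg L2_inner_nonpos) auto
  have q2: "q\<^sup>2 > 0"
    using q by simp
  note discrim = discrim_relaxed[of q At \<alpha> Bt Ct]
  have root: "\<exists>r. A1 * r\<^sup>2 + B1 * r + C1 = 0"
    if "0 \<le> q\<^sup>2 * discrim (At + \<alpha>) Bt (Ct - \<alpha> * q\<^sup>2)" "At + \<alpha> \<noteq> 0 \<or> Bt \<noteq> 0"
    unfolding A1 B1 C1 using that q2 by (intro quadratic_root_exists) (auto simp: zero_le_mult_iff)
  show ?thesis
  proof (intro conjI impI; (elim conjE)?)
    assume less: "(At * q\<^sup>2 + Ct)\<^sup>2 < q\<^sup>2 * Bt\<^sup>2"
    \<comment> \<open>Strictness excludes a constant equation, whatever the leading coefficient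
      is.\<close>
    have "Bt \<noteq> 0"
    proof
      assume "Bt = 0"
      with less have "(At * q\<^sup>2 + Ct)\<^sup>2 < 0"
        by simp
      then show False
        by simp
    qed
    with less show "\<exists>r. A1 * r\<^sup>2 + B1 * r + C1 = 0"
      by (intro root) (simp_all add: discrim)
  next
    assume le: "q\<^sup>2 * Bt\<^sup>2 \<le> (At * q\<^sup>2 + Ct)\<^sup>2" and star: "alpha_star At Bt Ct q \<le> \<alpha>"
      and nz: "\<alpha> = 0 \<longrightarrow> At \<noteq> 0 \<or> Bt \<noteq> 0"
    define D where "D = (At * q\<^sup>2 + Ct)\<^sup>2 - q\<^sup>2 * Bt\<^sup>2"
    have "(Ct - At * q\<^sup>2 + sqrt D) / (2 * q\<^sup>2) \<le> \<alpha>"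
      using star by (simp add: alpha_star_def D_def)
    then have "sqrt D \<le> 2 * \<alpha> * q\<^sup>2 + At * q\<^sup>2 - Ct"
      using q2 by (simp add: pos_divide_le_eq algebra_simps)
    moreover have "0 \<le> D"
      using le by (simp add: D_def)
    \<comment> \<open>The bound on \<open>sqrt D\<close> can be squared because
      \<open>sqrt D\<close> is nonnegative.\<close>
    ultimately have "D \<le> (2 * \<alpha> * q\<^sup>2 + At * q\<^sup>2 - Ct)\<^sup>2"
      by (metis real_le_lsqrt real_sqrt_le_iff real_sqrt_abs abs_ge_self order_trans)
    then have "0 \<le> q\<^sup>2 * discrim (At + \<alpha>) Bt (Ct - \<alpha> * q\<^sup>2)"
      by (simp add: discrim D_def)
    \<comment> \<open>Both summands are nonnegative, so a zero sum forces \<open>At\<close> =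
      \<alpha> = 0, and then \<open>nz\<close> gives a nonzero \<open>Bt\<close>.\<close>
    moreover have "At + \<alpha> \<noteq> 0 \<or> Bt \<noteq> 0"
      using At0 \<alpha> nz by auto
    ultimately show "\<exists>r. A1 * r\<^sup>2 + B1 * r + C1 = 0"
      by (rule root)
  qed
qed

end
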